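(* Let $v_1>v_0\ge0$ be fixed. Then the function $C\mapsto F(v_0,v_1,C)$ is strictly increasing on the interval $[0,v_1^{-1/2})$ and convex on the interval $(0,v_1^{-1/2})$.
   Context: For $C\ne0$ and $v\in[0,C^{-2}]$ put $$\overline F(v,C)=\frac{\arcsin(C\sqrt v)}{C^2}-\frac{\sqrt v\sqrt{1-C^2v}}{C}.$$ For $0<C\le v_1^{-1/2}$ put $F(v_0,v_1,C)=\overline F(v_1,C)-\overline F(v_0,C)$, and $F(v_0,v_1,0)=0$ (continuous extension). *)

theory Defs
  imports "HOL-Analysis.Analysis"
begin

text \<open>Meaningful for \<open>C \<noteq> 0\<close> and \<open>0 \<le> v \<le> 1 / C\<^sup>2\<close>, where the arguments of
  \<open>arcsin\<close> and \<open>sqrt\<close> lie in their domains.\<close>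

definition Fbar :: "real \<Rightarrow> real \<Rightarrow> real" where
  "Fbar v C = arcsin (C * sqrt v) / C\<^sup>2 - sqrt v * sqrt (1 - C\<^sup>2 * v) / C"

text \<open>Meaningful for \<open>0 \<le> v0 < v1\<close> and \<open>0 \<le> C \<le> v1 powr (-1/2)\<close>;
  the value at \<open>C = 0\<close> is the limit from the right.\<close>

definition F :: "real \<Rightarrow> real \<Rightarrow> real \<Rightarrow> real" where
  "F v0 v1 C = (if C = 0 then 0 else Fbar v1 C - Fbar v0 C)"

end

theory Submission
  imports Defs
begin

text \<open>In the variable \<open>s = sqrt v\<close> the derivative of \<open>Fbar (s\<^sup>2) C\<close> is
  \<open>2 s\<^sup>2 g\<^sub>s(C)\<close> with \<open>g\<^sub>s(C) = C / sqrt (1 - C\<^sup>2 s\<^sup>2)\<close>, so that \<open>F v0 v1 C\<close> is the integral of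
  \<open>2 s\<^sup>2 g\<^sub>s(C)\<close> over \<open>[sqrt v0, sqrt v1]\<close>. Each \<open>g\<^sub>s\<close> is strictly increasing and convex in \<open>C\<close>,
  and these properties pass to \<open>F\<close>. Instead of integrating, we apply the mean value theorem
  in \<open>s\<close> to the differences and convex combinations concerned.\<close>

text \<open>The value \<open>0\<close> at \<open>C = 0\<close> makes the derivative formula hold there too, so that
  monotonicity at the endpoint \<open>C = 0\<close> is not a separate case.\<close>

definition Fbar_ext :: "real \<Rightarrow> real \<Rightarrow> real" where
  "Fbar_ext C s = (if C = 0 then 0 else arcsin (C * s) / C\<^sup>2 - s * sqrt (1 - C\<^sup>2 * s\<^sup>2) / C)"

lemma F_eq_Fbar_ext:
  assumes "0 \<le> v0" "v0 \<le> v1"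
  shows "F v0 v1 C = Fbar_ext C (sqrt v1) - Fbar_ext C (sqrt v0)"
  using assms by (simp add: F_def Fbar_def Fbar_ext_def)

definition kernel :: "real \<Rightarrow> real \<Rightarrow> real" where
  "kernel s C = C / sqrt (1 - C\<^sup>2 * s\<^sup>2)"

lemma one_minus_sq_pos:
  fixes C s :: real
  assumes "0 \<le> C" "0 \<le> s" "C * s < 1"
  shows "0 < 1 - C\<^sup>2 * s\<^sup>2"
proof -
  have "(C * s)\<^sup>2 < 1\<^sup>2"
    using assms by (intro power_strict_mono) auto
  then show ?thesis
    by (simp add: power_mult_distrib)
qed

text \<open>The product rule and the derivative of arcsin give
  \<open>1 / (C * q) - q / C + C * s\<^sup>2 / q\<close> with
  \<open>q = sqrt (1 - C\<^sup>2 * s\<^sup>2)\<close>. Working in \<open>s\<close> instead of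
  \<open>v\<close> keeps the formula valid at \<open>s = 0\<close>, where the square root is not
  differentiable; so \<open>v0 = 0\<close> is no special case.\<close>

lemma Fbar_ext_has_derivative:
  assumes "0 \<le> C" "0 \<le> s" "C * s < 1"
  shows "(Fbar_ext C has_real_derivative 2 * s\<^sup>2 * kernel s C) (at s)"
proof (cases "C = 0")
  case True
  then have "Fbar_ext C = (\<lambda>s. 0)"
    by (simp add: Fbar_ext_def fun_eq_iff)
  then show ?thesis
    using True by (simp add: kernel_def)
next
  case False
  define w where "w = 1 - C\<^sup>2 * s\<^sup>2"
  define q where "q = sqrt w"
  have w: "0 < w"
    using one_minus_sq_pos[OF assms] by (simp add: w_def)
  then have q: "0 < q" "q * q = w"
    by (simp_all add: q_def)
  have lower: "-1 < C * s"
    using mult_nonneg_nonneg[OF assms(1,2)] by linarith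
  have arcsin': "((\<lambda>s. arcsin (C * s)) has_real_derivative inverse q * C) (at s)"
    unfolding q_def w_def using assms(3) lower
    by (auto intro!: derivative_eq_intros simp: power_mult_distrib)
  have sqrt': "((\<lambda>s. sqrt (1 - C\<^sup>2 * s\<^sup>2)) has_real_derivative - (C\<^sup>2 * s) / q) (at s)"
    unfolding q_def w_def using w[unfolded w_def]
    by (auto intro!: derivative_eq_intros simp: field_simps)
  have "((\<lambda>s. arcsin (C * s) / C\<^sup>2 - s * sqrt (1 - C\<^sup>2 * s\<^sup>2) / C) has_real_derivative
      inverse q * C / C\<^sup>2 - (1 * q + (- (C\<^sup>2 * s) / q) * s) / C) (at s)"
    unfolding q_def w_def
    by (rule DERIV_diff DERIV_cdivide DERIV_mult DERIV_ident
        arcsin'[unfolded q_def w_def] sqrt'[unfolded q_def w_def])+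
  moreover have "inverse q * C / C\<^sup>2 - (1 * q + (- (C\<^sup>2 * s) / q) * s) / C = 2 * s\<^sup>2 * (C / q)"
  proof -
    \<comment> \<open>Over the common denominator \<open>C * q\<close>, the relation
      \<open>q * q = w\<close> turns the numerator into
      \<open>2 * C\<^sup>2 * s\<^sup>2\<close>.\<close>
    have "inverse q * C / C\<^sup>2 - (1 * q + (- (C\<^sup>2 * s) / q) * s) / C
        = (1 - q * q + C\<^sup>2 * s\<^sup>2) / (C * q)"
      using False q(1) by (simp add: divide_simps power2_eq_square algebra_simps)
    also have "\<dots> = 2 * s\<^sup>2 * (C / q)"
      using False q(1) unfolding q(2) w_def
      by (simp add: divide_simps power2_eq_square algebra_simps)
    finally show ?thesis .
  qed
  moreover have "Fbar_ext C = (\<lambda>s. arcsin (C * s) / C\<^sup>2 - s * sqrt (1 - C\<^sup>2 * s\<^sup>2) / C)"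
    using False by (simp add: Fbar_ext_def fun_eq_iff)
  ultimately show ?thesis
    by (simp add: kernel_def q_def w_def)
qed

text \<open>As \<open>C\<close> grows, the denominator does not increase. Strictness comes from the
  numerator, so \<open>s = 0\<close> is covered.\<close>

lemma kernel_strict_mono:
  assumes "0 \<le> C" "C < D" "0 \<le> s" "D * s < 1"
  shows "kernel s C < kernel s D"
proof -
  have D: "0 < 1 - D\<^sup>2 * s\<^sup>2"
    using assms by (intro one_minus_sq_pos) auto
  have le: "C\<^sup>2 * s\<^sup>2 \<le> D\<^sup>2 * s\<^sup>2"
    using assms by (intro mult_right_mono power_mono) auto
  have "C / sqrt (1 - C\<^sup>2 * s\<^sup>2) \<le> C / sqrt (1 - D\<^sup>2 * s\<^sup>2)"
    using assms(1) D le by (intro divide_left_mono) auto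
  also have "\<dots> < D / sqrt (1 - D\<^sup>2 * s\<^sup>2)"
    using assms(2) D by (intro divide_strict_right_mono) auto
  finally show ?thesis
    by (simp add: kernel_def)
qed

lemma kernel_has_derivative:
  assumes "0 \<le> C" "0 \<le> s" "C * s < 1"
  shows "(kernel s has_real_derivative 1 / sqrt (1 - C\<^sup>2 * s\<^sup>2) ^ 3) (at C)"
proof -
  define w where "w = 1 - C\<^sup>2 * s\<^sup>2"
  define q where "q = sqrt w"
  have w: "0 < w"
    using one_minus_sq_pos[OF assms] by (simp add: w_def)
  then have q: "0 < q" "q * q = w"
    by (simp_all add: q_def)
  have sqrt': "((\<lambda>C. sqrt (1 - C\<^sup>2 * s\<^sup>2)) has_real_derivative - (C * s\<^sup>2) / q) (at C)"
    unfolding q_def w_def using w[unfolded w_def]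
    by (auto intro!: derivative_eq_intros simp: field_simps)
  have "((\<lambda>C. C / sqrt (1 - C\<^sup>2 * s\<^sup>2)) has_real_derivative
      (1 * q - C * (- (C * s\<^sup>2) / q)) / (q * q)) (at C)"
    unfolding q_def w_def using w[unfolded w_def]
    by (intro DERIV_divide DERIV_ident sqrt'[unfolded q_def w_def]) auto
  moreover have "(1 * q - C * (- (C * s\<^sup>2) / q)) / (q * q) = 1 / q ^ 3"
  proof -
    \<comment> \<open>The numerator on the right is 1 by the choice of \<open>q\<close>.\<close>
    have "(1 * q - C * (- (C * s\<^sup>2) / q)) / (q * q) = (q * q + C\<^sup>2 * s\<^sup>2) / q ^ 3"
      using q(1) by (simp add: divide_simps power2_eq_square power3_eq_cube)
    then show ?thesis
      by (simp add: q(2) w_def)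
  qed
  moreover have "kernel s = (\<lambda>C. C / sqrt (1 - C\<^sup>2 * s\<^sup>2))"
    by (simp add: kernel_def fun_eq_iff)
  ultimately show ?thesis
    by (simp add: q_def w_def)
qed

text \<open>The derivative \<open>1 / sqrt (1 - C\<^sup>2 * s\<^sup>2) ^ 3\<close> is nondecreasing
  in \<open>C\<close>, because the radicand decreases or stays constant.\<close>

lemma kernel_convex:
  assumes "0 \<le> s" "b * s \<le> 1"
  shows "convex_on {0<..<b} (kernel s)"
proof (rule convex_on_realI)
  have lt1: "C * s < 1" if "C \<in> {0<..<b}" for C
  proof (cases "s = 0")
    case False
    then have "C * s < b * s"
      using assms(1) that by simp
    then show ?thesis
      using assms(2) by linarith
  qed simp
  show "(kernel s has_real_derivative 1 / sqrt (1 - C\<^sup>2 * s\<^sup>2) ^ 3) (at C)"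
    if "C \<in> {0<..<b}" for C
    using that lt1[OF that] assms(1) by (intro kernel_has_derivative) auto
  show "1 / sqrt (1 - C\<^sup>2 * s\<^sup>2) ^ 3 \<le> 1 / sqrt (1 - D\<^sup>2 * s\<^sup>2) ^ 3"
    if "C \<in> {0<..<b}" "D \<in> {0<..<b}" "C \<le> D" for C D
  proof -
    have "0 < 1 - D\<^sup>2 * s\<^sup>2"
      using that(2) lt1[OF that(2)] assms(1) by (intro one_minus_sq_pos) auto
    moreover have "C\<^sup>2 * s\<^sup>2 \<le> D\<^sup>2 * s\<^sup>2"
      using that by (intro mult_right_mono power_mono) auto
    ultimately show ?thesis
      by (intro divide_left_mono power_mono mult_pos_pos zero_less_power) auto
  qed
qed simp

theorem lemma8:
  fixes v0 v1 :: real
  assumes "0 \<le> v0" and "v0 < v1"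
  shows "strict_mono_on {0..<v1 powr (-1/2)} (\<lambda>C. F v0 v1 C)
       \<and> convex_on {0<..<v1 powr (-1/2)} (\<lambda>C. F v0 v1 C)"
proof -
  define b where "b = v1 powr (-1/2)"
  define s0 where "s0 = sqrt v0"
  define s1 where "s1 = sqrt v1"
  have s: "0 \<le> s0" "s0 < s1"
    using assms by (auto simp: s0_def s1_def)
  \<comment> \<open>Thus \<open>C < b\<close> says exactly that \<open>C * s1 < 1\<close>, which
    keeps all radicands positive up to \<open>s1\<close>.\<close>
  have bs1: "b * s1 = 1"
    using assms by (simp add: b_def s1_def powr_half_sqrt[symmetric] powr_add[symmetric])
  have F: "F v0 v1 C = Fbar_ext C s1 - Fbar_ext C s0" for C
    using assms F_eq_Fbar_ext[of v0 v1 C] by (simp add: s0_def s1_def)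
  have lt1: "C * s < 1" if "0 \<le> C" "C < b" "s \<le> s1" for C s
  proof -
    have "C * s \<le> C * s1"
      using that by (intro mult_left_mono) auto
    also have "\<dots> < b * s1"
      using that s by (intro mult_strict_right_mono) auto
    finally show ?thesis
      by (simp add: bs1)
  qed
  have deriv: "(Fbar_ext C has_real_derivative 2 * s\<^sup>2 * kernel s C) (at s)"
    if "0 \<le> C" "C < b" "s0 \<le> s" "s \<le> s1" for C s
    using that lt1[of C s] s(1) by (intro Fbar_ext_has_derivative) auto
  have "F v0 v1 C < F v0 v1 D" if CD: "0 \<le> C" "C < D" "D < b" for C D
  proof -
    \<comment> \<open>The mean value theorem is applied to the difference
      \<open>Fbar_ext D - Fbar_ext C\<close>, so that both kernels are evaluated at the same
      \<open>s\<close>.\<close>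
    have "\<exists>s>s0. s < s1 \<and> (Fbar_ext D s1 - Fbar_ext C s1) - (Fbar_ext D s0 - Fbar_ext C s0)
        = (s1 - s0) * (2 * s\<^sup>2 * kernel s D - 2 * s\<^sup>2 * kernel s C)"
      using CD by (intro MVT2 s(2) DERIV_diff deriv) auto
    then obtain s where sI: "s0 < s" "s < s1"
      and eq: "F v0 v1 D - F v0 v1 C = (s1 - s0) * (2 * s\<^sup>2 * kernel s D - 2 * s\<^sup>2 * kernel s C)"
      by (auto simp: F algebra_simps)
    have "kernel s C < kernel s D"
      using CD sI s lt1[of D s] by (intro kernel_strict_mono) auto
    \<comment> \<open>Strictness survives since \<open>s > s0 \<ge> 0\<close>, even when
      \<open>s0 = 0\<close>.\<close>
    then have "2 * s\<^sup>2 * kernel s C < 2 * s\<^sup>2 * kernel s D"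
      using sI s by (intro mult_strict_left_mono) auto
    then show ?thesis
      using eq s(2) mult_pos_pos[of "s1 - s0" "2 * s\<^sup>2 * kernel s D - 2 * s\<^sup>2 * kernel s C"]
      by linarith
  qed
  then have "strict_mono_on {0..<b} (F v0 v1)"
    by (auto intro!: strict_mono_onI)
  moreover have "convex_on {0<..<b} (F v0 v1)"
  proof (rule convex_onI)
    fix t x y :: real
    assume t: "0 < t" "t < 1" and x: "x \<in> {0<..<b}" and y: "y \<in> {0<..<b}"
    define z where "z = (1 - t) * x + t * y"
    have z: "z \<in> {0<..<b}"
      using convexD[OF convex_real_interval(8)[of 0 b] x y, of "1 - t" t] t by (simp add: z_def)
    \<comment> \<open>The increment of \<open>h\<close> from \<open>s0\<close> to \<open>s1\<close>
      is the gap in the convexity inequality for \<open>F\<close>, and \<open>h'\<close> is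
      \<open>2 * s\<^sup>2\<close> times the corresponding gap for \<open>kernel s\<close>.\<close>
    define h where "h = (\<lambda>s. (1 - t) * Fbar_ext x s + t * Fbar_ext y s - Fbar_ext z s)"
    define h' where
      "h' = (\<lambda>s. (1 - t) * (2 * s\<^sup>2 * kernel s x) + t * (2 * s\<^sup>2 * kernel s y) - 2 * s\<^sup>2 * kernel s z)"
    have "\<exists>s>s0. s < s1 \<and> h s1 - h s0 = (s1 - s0) * h' s"
      unfolding h_def h'_def using x y z
      by (intro MVT2 s(2) DERIV_diff DERIV_add DERIV_cmult deriv) auto
    then obtain s where sI: "s0 < s" "s < s1" and eq: "h s1 - h s0 = (s1 - s0) * h' s"
      by auto
    have "b * s \<le> b * s1"
      using sI by (intro mult_left_mono) (auto simp: b_def)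
    then have "convex_on {0<..<b} (kernel s)"
      using sI s bs1 by (intro kernel_convex) auto
    from convex_onD[OF this, of t x y] have "kernel s z \<le> (1 - t) * kernel s x + t * kernel s y"
      using t x y by (simp add: z_def)
    then have "0 \<le> 2 * s\<^sup>2 * ((1 - t) * kernel s x + t * kernel s y - kernel s z)"
      by simp
    also have "\<dots> = h' s"
      by (simp add: h'_def algebra_simps)
    finally have "h s0 \<le> h s1"
      using eq s(2) mult_nonneg_nonneg[of "s1 - s0" "h' s"] by linarith
    then show "F v0 v1 ((1 - t) *\<^sub>R x + t *\<^sub>R y) \<le> (1 - t) * F v0 v1 x + t * F v0 v1 y"
      by (simp add: h_def F z_def algebra_simps)
  qed simp
  ultimately show ?thesis
    by (simp add: b_def)
qed

end
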